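(* Let $k\ge 2$ and $n=2k+1$. The friendship graph $F^{k}_{n}$ is determined by its $D$-spectrum: every connected graph $D$-cospectral to $F^{k}_{n}$ is isomorphic to $F^{k}_{n}$.
   Context: All graphs are simple, undirected and connected. For a connected graph $G$, the distance matrix $D(G)$ has as $(i,j)$-entry the distance between the $i$-th and $j$-th vertices; its eigenvalues form the $D$-spectrum of $G$. Two graphs are $D$-cospectral if they have the same $D$-spectrum; $G$ is determined by its $D$-spectrum if every graph $D$-cospectral to $G$ is isomorphic to $G$. The friendship graph $F^{k}_{n}$ ($n=2k+1$) is the graph obtained by taking $k$ copies of the cycle $C_3$ and identifying one vertex from each copy into a single common vertex. *)

theory Defs
  imports "Jordan_Normal_Form.Char_Poly"
begin

definition simple_graph :: "nat \<Rightarrow> (nat \<Rightarrow> nat \<Rightarrow> bool) \<Rightarrow> bool" where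
  "simple_graph n E \<longleftrightarrow> (\<forall>i j. E i j \<longrightarrow> i < n \<and> j < n) \<and> (\<forall>i j. E i j \<longrightarrow> E j i) \<and> (\<forall>i. \<not> E i i)"

definition is_walk :: "(nat \<Rightarrow> nat \<Rightarrow> bool) \<Rightarrow> nat list \<Rightarrow> nat \<Rightarrow> nat \<Rightarrow> nat \<Rightarrow> bool" where
  "is_walk E xs k i j \<longleftrightarrow> length xs = Suc k \<and> hd xs = i \<and> last xs = j \<and>
     (\<forall>l < k. E (xs ! l) (xs ! Suc l))"

definition connected_graph :: "nat \<Rightarrow> (nat \<Rightarrow> nat \<Rightarrow> bool) \<Rightarrow> bool" where
  "connected_graph n E \<longleftrightarrow> (\<forall>i < n. \<forall>j < n. \<exists>xs k. is_walk E xs k i j)"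

definition gdist :: "(nat \<Rightarrow> nat \<Rightarrow> bool) \<Rightarrow> nat \<Rightarrow> nat \<Rightarrow> nat" where
  "gdist E i j = (LEAST k. \<exists>xs. is_walk E xs k i j)"

definition distance_matrix :: "nat \<Rightarrow> (nat \<Rightarrow> nat \<Rightarrow> bool) \<Rightarrow> real mat" where
  "distance_matrix n E = mat n n (\<lambda>(i, j). real (gdist E i j))"

definition D_spectrum :: "nat \<Rightarrow> (nat \<Rightarrow> nat \<Rightarrow> bool) \<Rightarrow> complex multiset" where
  "D_spectrum n E = proots (char_poly (map_mat complex_of_real (distance_matrix n E)))"

definition D_cospectral :: "nat \<Rightarrow> (nat \<Rightarrow> nat \<Rightarrow> bool) \<Rightarrow> nat \<Rightarrow> (nat \<Rightarrow> nat \<Rightarrow> bool) \<Rightarrow> bool" where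
  "D_cospectral n E m E' \<longleftrightarrow> D_spectrum n E = D_spectrum m E'"

definition graph_iso :: "nat \<Rightarrow> (nat \<Rightarrow> nat \<Rightarrow> bool) \<Rightarrow> nat \<Rightarrow> (nat \<Rightarrow> nat \<Rightarrow> bool) \<Rightarrow> bool" where
  "graph_iso n E m E' \<longleftrightarrow> (\<exists>f. bij_betw f {..<n} {..<m} \<and> (\<forall>i < n. \<forall>j < n. E i j \<longleftrightarrow> E' (f i) (f j)))"

text \<open>Friendship graph F^k_{2k+1}: centre 0, triangles {0, 2t-1, 2t} for t = 1..k.\<close>
definition friendship_graph :: "nat \<Rightarrow> nat \<Rightarrow> nat \<Rightarrow> bool" where
  "friendship_graph k i j \<longleftrightarrow> i < 2*k+1 \<and> j < 2*k+1 \<and> i \<noteq> j \<and>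
     (i = 0 \<or> j = 0 \<or> (i + 1) div 2 = (j + 1) div 2)"

end

theory Submission
  imports Defs
begin

text \<open>Real symmetric matrices with equal characteristic polynomials are orthogonally similar, so the
  distance forms of \<open>G\<close> and of the friendship graph differ by a linear isometry. For the friendship
  graph the form \<open>Q\<close> satisfies \<open>Q(x) \<ge> -3 |x|^2\<close> everywhere and \<open>Q(x) \<le> -1/2 |x|^2\<close> on a hyperplane;
  these two properties carry over to \<open>G\<close>. The first excludes two vertices at distance 3, since a
  geodesic on four vertices has distance eigenvalue \<open>-2 - sqrt 2\<close>. The second excludes induced
  \<open>P4\<close> and \<open>C4\<close>, each of which has two distance eigenvalues above \<open>-1/2\<close>. A connected graph without
  induced \<open>P4\<close> and \<open>C4\<close> has a dominating vertex \<open>v\<close>. The traces of \<open>D^2\<close> and \<open>D^3\<close> then determine the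
  number of edges and six times the sum of squared degrees minus \<open>tr A^3\<close>, and bounding the triangles at
  every \<open>i \<noteq> v\<close> by \<open>deg i (deg i - 1)\<close> forces all degrees other than that of \<open>v\<close> to be 2.\<close>

section \<open>Orthogonal similarity of cospectral symmetric matrices\<close>

text \<open>Reflection in the hyperplane orthogonal to v - e_0 interchanges the unit vectors v and
  e_0, and a reflection is symmetric and its own inverse. If the first entry of v is 1, then v is
  already e_0 and the identity serves.\<close>

lemma Householder_unit_vec:
  fixes v :: "real vec"
  assumes v: "v \<in> carrier_vec n" and n: "0 < n" and unit: "v \<bullet> v = 1"
  shows "\<exists>W \<in> carrier_mat n n. W\<^sup>T = W \<and> W * W = 1\<^sub>m n \<and> W *\<^sub>v unit_vec n 0 = v"
proof (cases "v $ 0 = 1")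
  case True
  have "(\<Sum>i<n. (v $ i)\<^sup>2) = 1"
    using unit v by (simp add: scalar_prod_def power2_eq_square atLeast0LessThan)
  moreover have "(\<Sum>i<n. (v $ i)\<^sup>2) = (v $ 0)\<^sup>2 + (\<Sum>i\<in>{..<n} - {0}. (v $ i)\<^sup>2)"
    using n by (intro sum.remove) auto
  ultimately have "(\<Sum>i\<in>{..<n} - {0}. (v $ i)\<^sup>2) = 0" using True by simp
  then have "\<forall>i\<in>{..<n} - {0}. (v $ i)\<^sup>2 = 0"
    by (subst (asm) sum_nonneg_eq_0_iff) auto
  then have "v = unit_vec n 0"
    using v n True by (intro eq_vecI) (auto simp: unit_vec_def)
  then show ?thesis by (intro bexI[of _ "1\<^sub>m n"]) auto
next
  case False
  \<comment> \<open>For w = v - e_0 the squared norm is 2 - 2 v_0, so c = 2/|w|^2 and W = I - c w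
    w^T is the Householder reflection.\<close>
  define c where "c = 1 / (1 - v $ 0)"
  define w where "w i = v $ i - (if i = 0 then 1 else 0)" for i
  define W where "W = mat n n (\<lambda>(i, j). (if i = j then 1 else 0) - c * w i * w j)"
  have "(\<Sum>i<n. (v $ i)\<^sup>2) = 1"
    using unit v by (simp add: scalar_prod_def power2_eq_square atLeast0LessThan)
  moreover have "(w i)\<^sup>2 = (v $ i)\<^sup>2 + (if i = 0 then 1 - 2 * v $ 0 else 0)" for i
    by (simp add: w_def power2_eq_square algebra_simps)
  ultimately have "(\<Sum>i<n. (w i)\<^sup>2) = 2 - 2 * v $ 0"
    using n by (simp add: sum.distrib sum.delta)
  then have c: "c * (\<Sum>i<n. (w i)\<^sup>2) = 2"
    using False by (simp add: c_def field_simps)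
  have W: "W \<in> carrier_mat n n" by (simp add: W_def)
  moreover have "W\<^sup>T = W" by (rule eq_matI) (auto simp: W_def)
  moreover have "W * W = 1\<^sub>m n"
  proof (rule eq_matI)
    fix i j assume "i < dim_row (1\<^sub>m n)" "j < dim_col (1\<^sub>m n)"
    then have ij: "i < n" "j < n" by auto
    have "(W * W) $$ (i, j) = (\<Sum>k<n. ((if i = k then 1 else 0) - c * w i * w k) *
        ((if k = j then 1 else 0) - c * w k * w j))"
      using ij by (simp add: W_def scalar_prod_def atLeast0LessThan)
    also have "\<dots> = (\<Sum>k<n. (if k = i then (if i = j then 1 else 0) - c * w i * w j else 0)
        - (if k = j then c * w i * w j else 0) + c * w i * w j * (c * (w k)\<^sup>2))"
      by (intro sum.cong) (auto simp: power2_eq_square algebra_simps)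
    also have "\<dots> = (if i = j then 1 else 0) - 2 * (c * w i * w j)
        + c * w i * w j * (c * (\<Sum>k<n. (w k)\<^sup>2))"
      using ij by (simp add: sum.distrib sum_subtractf sum_distrib_left)
    finally show "(W * W) $$ (i, j) = 1\<^sub>m n $$ (i, j)"
      using ij by (simp add: c)
  qed (auto simp: W_def)
  moreover have "W *\<^sub>v unit_vec n 0 = v"
  proof (rule eq_vecI)
    fix i assume "i < dim_vec v"
    then have i: "i < n" using v by simp
    have "c * w 0 = -1" using False by (simp add: c_def w_def field_simps)
    moreover have "(W *\<^sub>v unit_vec n 0) $ i = (if i = 0 then 1 else 0) - w i * (c * w 0)"
      using i n by (simp add: W_def)
    ultimately show "(W *\<^sub>v unit_vec n 0) $ i = v $ i" by (simp add: w_def)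
  qed (use v in \<open>simp add: W_def\<close>)
  ultimately show ?thesis by blast
qed

text \<open>Deflation, by induction on the list of roots: a reflection moves a unit eigenvector for
  the first root to e_0, symmetry clears the first row along with the first column, and the
  remaining block is symmetric with the remaining roots. The diagonal keeps the order of
  \<open>es\<close>, so that two matrices with the same roots reach the same diagonal form.\<close>

lemma orthogonal_diagonalization:
  fixes A :: "real mat"
  assumes "A \<in> carrier_mat n n" and "A\<^sup>T = A" and "char_poly A = (\<Prod>e\<leftarrow>es. [:- e, 1:])"
  shows "\<exists>P \<in> carrier_mat n n. P\<^sup>T * P = 1\<^sub>m n \<and> P\<^sup>T * A * P = mat n n (\<lambda>(i, j). if i = j then es ! i else 0)"
  using assms
proof (induction es arbitrary: n A)
  case Nil
  with degree_monic_char_poly[of A n] have "n = 0" by auto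
  then show ?case using Nil by (intro bexI[of _ "1\<^sub>m 0"]) auto
next
  case (Cons e es)
  note A = Cons.prems(1) and sym = Cons.prems(2)
  let ?m = "n - 1"
  have "degree (char_poly A) = Suc (length es)"
    unfolding Cons.prems(3) by (subst degree_linear_factors) simp
  with degree_monic_char_poly[OF A] have n: "n = Suc ?m" "0 < n" by auto
  have "eigenvalue A e"
    unfolding eigenvalue_root_char_poly[OF A] Cons.prems(3) by simp
  then obtain u where u: "u \<in> carrier_vec n" "u \<noteq> 0\<^sub>v n" "A *\<^sub>v u = e \<cdot>\<^sub>v u"
    using A unfolding eigenvalue_def eigenvector_def by auto
  have pos: "u \<bullet> u > 0"
    using conjugate_square_greater_0_vec[OF u(1)] u(2) by (simp add: conjugate_vec_def vec_eq_iff)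
  define v where "v = (1 / sqrt (u \<bullet> u)) \<cdot>\<^sub>v u"
  have v: "v \<in> carrier_vec n" "v \<bullet> v = 1" "A *\<^sub>v v = e \<cdot>\<^sub>v v"
    using u pos A by (auto simp: v_def mult_mat_vec smult_smult_assoc ac_simps)
  obtain W where W: "W \<in> carrier_mat n n" "W\<^sup>T = W" "W * W = 1\<^sub>m n" "W *\<^sub>v unit_vec n 0 = v"
    using Householder_unit_vec[OF v(1) n(2) v(2)] by auto
  define A' where "A' = W * A * W"
  have A': "A' \<in> carrier_mat n n" using W A by (simp add: A'_def)
  have symA': "A'\<^sup>T = A'"
    using W A sym unfolding A'_def by (simp add: transpose_mult[of _ n n _ n] assoc_mult_mat[of _ n n _ n _ n])
  have Wv: "W *\<^sub>v v = unit_vec n 0"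
    using W(1,3) unfolding W(4)[symmetric] by (simp add: assoc_mult_mat_vec[symmetric, of _ n n _ n])
  have "A' *\<^sub>v unit_vec n 0 = W *\<^sub>v (A *\<^sub>v (W *\<^sub>v unit_vec n 0))"
    using W A unfolding A'_def by (simp add: assoc_mult_mat_vec[of _ n n _ n])
  also have "\<dots> = e \<cdot>\<^sub>v unit_vec n 0"
    using W(1) v by (simp add: W(4) mult_mat_vec Wv)
  finally have ev: "A' *\<^sub>v unit_vec n 0 = e \<cdot>\<^sub>v unit_vec n 0" .
  have col0: "A' $$ (i, 0) = (if i = 0 then e else 0)" if "i < n" for i
    using arg_cong[OF ev, of "\<lambda>x. x $ i"] that n(2) A' by (cases "i = 0") auto
  have row0: "A' $$ (0, i) = (if i = 0 then e else 0)" if "i < n" for i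
    using arg_cong[OF symA', of "\<lambda>M. M $$ (i, 0)"] col0[OF that] that n(2) A' by simp
  define B where "B = mat ?m ?m (\<lambda>(i, j). A' $$ (Suc i, Suc j))"
  have B: "B \<in> carrier_mat ?m ?m" by (simp add: B_def)
  have "B $$ (j, i) = B $$ (i, j)" if "i < ?m" "j < ?m" for i j
    using arg_cong[OF symA', of "\<lambda>M. M $$ (Suc i, Suc j)"] that A' by (simp add: B_def)
  then have symB: "B\<^sup>T = B" by (intro eq_matI) (auto simp: B_def)
  define E where "E = mat 1 1 (\<lambda>_. e)"
  have block: "A' = four_block_mat E (0\<^sub>m 1 ?m) (0\<^sub>m ?m 1) B"
    using A' n col0 row0 by (intro eq_matI) (auto simp: E_def B_def less_Suc_eq_0_disj)
  have "similar_mat_wit A' A W W"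
    using W A A' by (intro similar_mat_witI[of _ _ n]) (auto simp: A'_def)
  then have "char_poly A' = char_poly A"
    using char_poly_similar unfolding similar_mat_def by blast
  moreover have "char_poly A' = char_poly E * char_poly B"
    unfolding block by (rule char_poly_four_block_zeros_col) (auto simp: E_def B_def)
  moreover have "char_poly E = [:- e, 1:]"
    by (simp add: E_def char_poly_defs det_def sign_def)
  ultimately have "[:- e, 1:] * char_poly B = [:- e, 1:] * (\<Prod>e\<leftarrow>es. [:- e, 1:])"
    by (simp add: Cons.prems(3))
  then have "char_poly B = (\<Prod>e\<leftarrow>es. [:- e, 1:])"
    by (metis mult_cancel_left pCons_eq_0_iff zero_neq_one)
  from Cons.IH[OF B symB this] obtain Q where Q: "Q \<in> carrier_mat ?m ?m" "Q\<^sup>T * Q = 1\<^sub>m ?m"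
    and QB: "Q\<^sup>T * B * Q = mat ?m ?m (\<lambda>(i, j). if i = j then es ! i else 0)" by auto
  \<comment> \<open>The orthogonal matrix of the smaller block is bordered by a 1; the full change
    of basis is \<open>W * R\<close>.\<close>
  define R where "R = four_block_mat (1\<^sub>m 1) (0\<^sub>m 1 ?m) (0\<^sub>m ?m 1) Q"
  have R: "R \<in> carrier_mat n n" using Q(1) n by (auto simp: R_def)
  have RT: "R\<^sup>T = four_block_mat (1\<^sub>m 1) (0\<^sub>m 1 ?m) (0\<^sub>m ?m 1) (Q\<^sup>T)"
    unfolding R_def by (subst transpose_four_block_mat[of _ 1 1 _ ?m _ ?m]) (use Q in auto)
  have "R\<^sup>T * R = four_block_mat (1\<^sub>m 1) (0\<^sub>m 1 ?m) (0\<^sub>m ?m 1) (1\<^sub>m ?m)"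
    unfolding RT unfolding R_def
    by (subst mult_four_block_mat[of _ 1 1 _ ?m _ ?m _ _ 1 _ ?m]) (use Q in auto)
  also have "\<dots> = 1\<^sub>m n" using n by (subst four_block_one_mat) simp
  finally have RR: "R\<^sup>T * R = 1\<^sub>m n" .
  have "R\<^sup>T * A' = four_block_mat E (0\<^sub>m 1 ?m) (0\<^sub>m ?m 1) (Q\<^sup>T * B)"
    unfolding RT block
    by (subst mult_four_block_mat[of _ 1 1 _ ?m _ ?m _ _ 1 _ ?m]) (use Q B in \<open>auto simp: E_def\<close>)
  then have "R\<^sup>T * A' * R = four_block_mat E (0\<^sub>m 1 ?m) (0\<^sub>m ?m 1) (Q\<^sup>T * B) * R" by simp
  also have "\<dots> = four_block_mat E (0\<^sub>m 1 ?m) (0\<^sub>m ?m 1) (Q\<^sup>T * B * Q)"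
    unfolding R_def
    by (subst mult_four_block_mat[of _ 1 1 _ ?m _ ?m _ _ 1 _ ?m]) (use Q B in \<open>auto simp: E_def\<close>)
  also have "\<dots> = mat n n (\<lambda>(i, j). if i = j then (e # es) ! i else 0)"
    unfolding QB using n by (intro eq_matI) (auto simp: E_def nth_Cons')
  finally have "R\<^sup>T * A' * R = mat n n (\<lambda>(i, j). if i = j then (e # es) ! i else 0)" .
  moreover have "(W * R)\<^sup>T = R\<^sup>T * W" using W R by (simp add: transpose_mult)
  moreover have "R\<^sup>T * W * (W * R) = R\<^sup>T * (W * W) * R"
    using W(1) R by (simp add: assoc_mult_mat[of _ n n _ n _ n])
  moreover have "R\<^sup>T * W * A * (W * R) = R\<^sup>T * A' * R"
    using W(1) R A by (simp add: A'_def assoc_mult_mat[of _ n n _ n _ n])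
  ultimately show ?case
    using W R RR by (intro bexI[of _ "W * R"]) auto
qed

text \<open>The polynomial splits over the complex numbers, and every root a is real: for an
  eigenvector v, the number v* A v equals a |v|^2 and, A being real symmetric, is its own
  conjugate.\<close>

lemma char_poly_real_symmetric_splits:
  fixes A :: "real mat"
  assumes A: "A \<in> carrier_mat n n" and sym: "A\<^sup>T = A"
  shows "\<exists>es. char_poly A = (\<Prod>e\<leftarrow>es. [:- e, 1:])"
proof -
  interpret of_real_poly: map_poly_inj_idom_hom complex_of_real ..
  let ?A = "map_mat complex_of_real A"
  have cA: "?A \<in> carrier_mat n n" using A by simp
  obtain as where as: "char_poly ?A = (\<Prod>a\<leftarrow>as. [:- a, 1:])"
    using char_poly_factorized[OF cA] by auto
  have real: "complex_of_real (Re a) = a" if "a \<in> set as" for a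
  proof -
    have "eigenvalue ?A a"
      unfolding eigenvalue_root_char_poly[OF cA] as using that by (auto simp: poly_prod_list prod_list_zero_iff)
    then obtain v where v: "v \<in> carrier_vec n" "v \<noteq> 0\<^sub>v n" "?A *\<^sub>v v = a \<cdot>\<^sub>v v"
      using A unfolding eigenvalue_def eigenvector_def by auto
    have row: "(\<Sum>j<n. complex_of_real (A $$ (i, j)) * v $ j) = a * v $ i" if "i < n" for i
      using arg_cong[OF v(3), of "\<lambda>x. x $ i"] that A v(1)
      by (simp add: scalar_prod_def atLeast0LessThan)
    have symA: "A $$ (j, i) = A $$ (i, j)" if "i < n" "j < n" for i j
      using arg_cong[OF sym, of "\<lambda>M. M $$ (i, j)"] that A by simp
    let ?N = "\<Sum>i<n. cnj (v $ i) * v $ i"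
    let ?S = "\<Sum>i<n. \<Sum>j<n. complex_of_real (A $$ (i, j)) * (cnj (v $ i) * v $ j)"
    have S: "?S = a * ?N"
      unfolding sum_distrib_left
    proof (rule sum.cong)
      fix i assume "i \<in> {..<n}"
      then have "a * v $ i = (\<Sum>j<n. complex_of_real (A $$ (i, j)) * v $ j)" using row by simp
      then have "a * (cnj (v $ i) * v $ i) = cnj (v $ i) * (\<Sum>j<n. complex_of_real (A $$ (i, j)) * v $ j)"
        by (simp add: ac_simps)
      then show "(\<Sum>j<n. complex_of_real (A $$ (i, j)) * (cnj (v $ i) * v $ j)) = a * (cnj (v $ i) * v $ i)"
        by (simp add: sum_distrib_left ac_simps)
    qed simp
    have "cnj ?S = (\<Sum>i<n. \<Sum>j<n. complex_of_real (A $$ (i, j)) * (cnj (v $ j) * v $ i))"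
      by (simp add: ac_simps)
    also have "\<dots> = (\<Sum>j<n. \<Sum>i<n. complex_of_real (A $$ (i, j)) * (cnj (v $ j) * v $ i))"
      by (rule sum.swap)
    also have "\<dots> = ?S" by (intro sum.cong refl) (simp add: symA)
    finally have "cnj a * cnj ?N = a * ?N" unfolding S by simp
    moreover have "cnj ?N = ?N" by (simp add: mult.commute)
    moreover have "?N \<noteq> 0"
    proof
      assume "?N = 0"
      moreover have "?N = complex_of_real (\<Sum>i<n. (cmod (v $ i))\<^sup>2)"
        by (simp add: complex_norm_square[symmetric] mult.commute)
      ultimately have "(\<Sum>i<n. (cmod (v $ i))\<^sup>2) = 0" by (metis of_real_eq_0_iff)
      then have "\<forall>i\<in>{..<n}. v $ i = 0" by (simp add: sum_nonneg_eq_0_iff)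
      then show False using v(1,2) by (auto simp: vec_eq_iff)
    qed
    ultimately have "cnj a = a" by simp
    then show ?thesis by (simp add: complex_eq_iff)
  qed
  have "map_poly complex_of_real (char_poly A) = char_poly ?A"
    using of_real_hom.char_poly_hom[OF A] by metis
  also have "\<dots> = (\<Prod>a\<leftarrow>as. map_poly complex_of_real [:- Re a, 1:])"
    unfolding as by (intro arg_cong[of _ _ prod_list] map_cong refl) (simp add: real)
  also have "\<dots> = map_poly complex_of_real (\<Prod>a\<leftarrow>map Re as. [:- a, 1:])"
    by (simp add: of_real_poly.hom_prod_list o_def)
  finally show ?thesis
    using of_real_poly.eq_iff by blast
qed

text \<open>One list \<open>es\<close> serves both matrices, so both become the same diagonal
  matrix; one change of basis followed by the inverse of the other gives W = Q P^T.\<close>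

lemma orthogonally_similar:
  fixes A B :: "real mat"
  assumes A: "A \<in> carrier_mat n n" "A\<^sup>T = A" and B: "B \<in> carrier_mat n n" "B\<^sup>T = B"
    and eq: "char_poly A = char_poly B"
  shows "\<exists>W \<in> carrier_mat n n. W\<^sup>T * W = 1\<^sub>m n \<and> W * W\<^sup>T = 1\<^sub>m n \<and> A = W\<^sup>T * B * W"
proof -
  obtain es where es: "char_poly A = (\<Prod>e\<leftarrow>es. [:- e, 1:])"
    using char_poly_real_symmetric_splits[OF A] by auto
  obtain P where P: "P \<in> carrier_mat n n" "P\<^sup>T * P = 1\<^sub>m n"
      "P\<^sup>T * A * P = mat n n (\<lambda>(i, j). if i = j then es ! i else 0)"
    using orthogonal_diagonalization[OF A es] by auto
  obtain Q where Q: "Q \<in> carrier_mat n n" "Q\<^sup>T * Q = 1\<^sub>m n"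
      "Q\<^sup>T * B * Q = mat n n (\<lambda>(i, j). if i = j then es ! i else 0)"
    using orthogonal_diagonalization[OF B es[unfolded eq]] by auto
  have PP: "P * P\<^sup>T = 1\<^sub>m n"
    using mat_mult_left_right_inverse[of "P\<^sup>T" n P] P by simp
  have QQ: "Q * Q\<^sup>T = 1\<^sub>m n"
    using mat_mult_left_right_inverse[of "Q\<^sup>T" n Q] Q by simp
  note assoc = assoc_mult_mat[of _ n n _ n _ n]
  have PPx: "P * (P\<^sup>T * X) = X" and QQx: "Q\<^sup>T * (Q * X) = X" and PPx': "P\<^sup>T * (P * X) = X"
    if "X \<in> carrier_mat n n" for X
    using that P Q PP by (simp_all add: assoc[symmetric])
  have "A = P * (P\<^sup>T * A * P) * P\<^sup>T" using P(1) A PP by (simp add: assoc PPx)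
  also have "\<dots> = P * (Q\<^sup>T * B * Q) * P\<^sup>T" using P(3) Q(3) by simp
  finally have "A = P * Q\<^sup>T * B * (Q * P\<^sup>T)" using P(1) Q(1) B by (simp add: assoc)
  moreover have "(Q * P\<^sup>T)\<^sup>T = P * Q\<^sup>T" using P(1) Q(1) by (simp add: transpose_mult)
  moreover have "P * Q\<^sup>T * (Q * P\<^sup>T) = 1\<^sub>m n" "Q * P\<^sup>T * (P * Q\<^sup>T) = 1\<^sub>m n"
    using P(1) Q(1) by (simp_all add: assoc QQx PPx' PP QQ)
  ultimately show ?thesis
    using P(1) Q(1) by (intro bexI[of _ "Q * P\<^sup>T"]) auto
qed

lemma sum_entries_mult_comm:
  fixes A B :: "'a :: comm_semiring_0 mat"
  assumes "A \<in> carrier_mat n n" "B \<in> carrier_mat n n"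
  shows "(\<Sum>i<n. (A * B) $$ (i, i)) = (\<Sum>i<n. (B * A) $$ (i, i))"
proof -
  have "(\<Sum>i<n. (A * B) $$ (i, i)) = (\<Sum>i<n. \<Sum>j<n. A $$ (i, j) * B $$ (j, i))"
    using assms by (simp add: scalar_prod_def atLeast0LessThan)
  also have "\<dots> = (\<Sum>j<n. \<Sum>i<n. A $$ (i, j) * B $$ (j, i))" by (rule sum.swap)
  also have "\<dots> = (\<Sum>i<n. (B * A) $$ (i, i))"
    using assms by (simp add: scalar_prod_def atLeast0LessThan mult.commute)
  finally show ?thesis .
qed

section \<open>Cospectrality as an isometry of quadratic forms\<close>

definition quad :: "nat \<Rightarrow> (nat \<Rightarrow> nat \<Rightarrow> real) \<Rightarrow> (nat \<Rightarrow> real) \<Rightarrow> real" where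
  "quad n d x = (\<Sum>i<n. \<Sum>j<n. d i j * x i * x j)"

text \<open>Orthogonal similarity in coordinates: \<open>w\<close> holds the entries of an
  orthogonal W with A = W^T B W, and the trace identities follow from cyclicity of the trace. The
  hypothesis is stated over the complex numbers to match \<open>D_spectrum\<close>.\<close>

lemma cospectral_isometry:
  fixes d d' :: "nat \<Rightarrow> nat \<Rightarrow> real"
  assumes sym: "\<And>i j. d i j = d j i" "\<And>i j. d' i j = d' j i"
    and eq: "char_poly (map_mat complex_of_real (mat n n (\<lambda>(i, j). d i j))) =
      char_poly (map_mat complex_of_real (mat n n (\<lambda>(i, j). d' i j)))"
  obtains w where "\<And>x. quad n d x = quad n d' (\<lambda>i. \<Sum>j<n. w i j * x j)"
    "\<And>x. (\<Sum>i<n. (\<Sum>j<n. w i j * x j)\<^sup>2) = (\<Sum>i<n. (x i)\<^sup>2)"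
    "(\<Sum>i<n. \<Sum>j<n. d i j * d j i) = (\<Sum>i<n. \<Sum>j<n. d' i j * d' j i)"
    "(\<Sum>i<n. \<Sum>j<n. \<Sum>k<n. d i j * d j k * d k i) = (\<Sum>i<n. \<Sum>j<n. \<Sum>k<n. d' i j * d' j k * d' k i)"
proof -
  interpret of_real_poly: map_poly_inj_idom_hom complex_of_real ..
  define A where "A = mat n n (\<lambda>(i, j). d i j)"
  define B where "B = mat n n (\<lambda>(i, j). d' i j)"
  have A: "A \<in> carrier_mat n n" "A\<^sup>T = A" and B: "B \<in> carrier_mat n n" "B\<^sup>T = B"
    by (auto simp: A_def B_def sym intro!: eq_matI)
  have "map_poly complex_of_real (char_poly A) = map_poly complex_of_real (char_poly B)"
    using eq of_real_hom.char_poly_hom[OF A(1)] of_real_hom.char_poly_hom[OF B(1)] unfolding A_def B_def by metis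
  then have "char_poly A = char_poly B" using of_real_poly.eq_iff by blast
  from orthogonally_similar[OF A B this] obtain W where W: "W \<in> carrier_mat n n"
    and WW: "W\<^sup>T * W = 1\<^sub>m n" "W * W\<^sup>T = 1\<^sub>m n" and AB: "A = W\<^sup>T * B * W" by auto
  note assoc = assoc_mult_mat[of _ n n _ n _ n]
  note sp = scalar_prod_def atLeast0LessThan
  have WT: "W\<^sup>T \<in> carrier_mat n n" using W by simp
  have adj: "x \<bullet> (W\<^sup>T *\<^sub>v y) = (W *\<^sub>v x) \<bullet> y" if x: "x \<in> carrier_vec n" and y: "y \<in> carrier_vec n" for x y
    using transpose_vec_mult_scalar[OF W x y] x y W
      comm_scalar_prod[of x n "W\<^sup>T *\<^sub>v y"] comm_scalar_prod[of y n "W *\<^sub>v x"]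
    by simp
  have quad: "quad n f x = vec n x \<bullet> (mat n n (\<lambda>(i, j). f i j) *\<^sub>v vec n x)" for f x
    by (simp add: quad_def sp sum_distrib_left ac_simps)
  have Wx: "vec n (\<lambda>i. \<Sum>j<n. W $$ (i, j) * x j) = W *\<^sub>v vec n x" for x
    using W by (intro eq_vecI) (auto simp: sp)
  show thesis
  proof (rule that[of "\<lambda>i j. W $$ (i, j)"])
    fix x :: "nat \<Rightarrow> real"
    have x: "vec n x \<in> carrier_vec n" by simp
    have "A *\<^sub>v vec n x = W\<^sup>T *\<^sub>v (B *\<^sub>v (W *\<^sub>v vec n x))"
      unfolding AB using W WT B x by (simp add: assoc_mult_mat_vec[of _ n n _ n])
    then have "vec n x \<bullet> (A *\<^sub>v vec n x) = (W *\<^sub>v vec n x) \<bullet> (B *\<^sub>v (W *\<^sub>v vec n x))"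
      using adj[OF x, of "B *\<^sub>v (W *\<^sub>v vec n x)"] B W x by simp
    then show "quad n d x = quad n d' (\<lambda>i. \<Sum>j<n. W $$ (i, j) * x j)"
      unfolding quad Wx A_def B_def .
    have "(W *\<^sub>v vec n x) \<bullet> (W *\<^sub>v vec n x) = vec n x \<bullet> (W\<^sup>T *\<^sub>v (W *\<^sub>v vec n x))"
      using adj[OF x, of "W *\<^sub>v vec n x"] W x by simp
    also have "\<dots> = vec n x \<bullet> ((W\<^sup>T * W) *\<^sub>v vec n x)"
      using W x WT by (simp add: assoc_mult_mat_vec[of _ n n _ n])
    also have "\<dots> = vec n x \<bullet> vec n x" by (simp add: WW)
    finally show "(\<Sum>i<n. (\<Sum>j<n. W $$ (i, j) * x j)\<^sup>2) = (\<Sum>i<n. (x i)\<^sup>2)"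
      unfolding Wx[symmetric] by (simp add: sp power2_eq_square)
  next
    have Wc: "W * (W\<^sup>T * X) = X" if "X \<in> carrier_mat n n" for X
      using that W by (simp add: assoc[symmetric] WW)
    have "A * A = W\<^sup>T * (B * B * W)" unfolding AB using W B by (simp add: assoc Wc)
    then have "(\<Sum>i<n. (A * A) $$ (i, i)) = (\<Sum>i<n. (B * B) $$ (i, i))"
      using sum_entries_mult_comm[of "W\<^sup>T" n "B * B * W"] W B by (simp add: assoc WW)
    then show "(\<Sum>i<n. \<Sum>j<n. d i j * d j i) = (\<Sum>i<n. \<Sum>j<n. d' i j * d' j i)"
      by (simp add: A_def B_def sp)
    have "A * (A * A) = W\<^sup>T * (B * (B * B) * W)" unfolding AB using W B by (simp add: assoc Wc)
    then have "(\<Sum>i<n. (A * (A * A)) $$ (i, i)) = (\<Sum>i<n. (B * (B * B)) $$ (i, i))"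
      using sum_entries_mult_comm[of "W\<^sup>T" n "B * (B * B) * W"] W B by (simp add: assoc WW)
    then show "(\<Sum>i<n. \<Sum>j<n. \<Sum>k<n. d i j * d j k * d k i) = (\<Sum>i<n. \<Sum>j<n. \<Sum>k<n. d' i j * d' j k * d' k i)"
      by (simp add: A_def B_def sp sum_distrib_left mult.assoc)
  qed
qed

section \<open>Distances and dominating vertices\<close>

text \<open>Turns vertex lists into relation powers, so that walks are joined and split by the laws
  of \<open>^^\<close>.\<close>

lemma is_walk_iff_relpowp: "(\<exists>xs. is_walk E xs k i j) \<longleftrightarrow> (E ^^ k) i j"
proof
  assume "\<exists>xs. is_walk E xs k i j"
  then obtain xs where xs: "length xs = Suc k" "hd xs = i" "last xs = j"
    "\<forall>l<k. E (xs ! l) (xs ! Suc l)" by (auto simp: is_walk_def)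
  moreover have "xs ! 0 = i" "xs ! k = j"
    using xs by (metis hd_conv_nth list.size(3) nat.distinct(1), metis diff_Suc_1 last_conv_nth list.size(3) nat.distinct(1))
  ultimately show "(E ^^ k) i j" unfolding relpowp_fun_conv by (intro exI[of _ "(!) xs"]) auto
next
  assume "(E ^^ k) i j"
  then obtain f where f: "f 0 = i" "f k = j" "\<forall>l<k. E (f l) (f (Suc l))"
    unfolding relpowp_fun_conv by auto
  then have "is_walk E (map f [0..<Suc k]) k i j"
    by (auto simp: is_walk_def hd_map last_map nth_append simp del: upt_Suc)
  then show "\<exists>xs. is_walk E xs k i j" by blast
qed

lemma gdist_eq_relpowp: "gdist E i j = (LEAST k. (E ^^ k) i j)"
  by (simp add: gdist_def is_walk_iff_relpowp)

lemma gdist_le: "(E ^^ k) i j \<Longrightarrow> gdist E i j \<le> k"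
  unfolding gdist_eq_relpowp by (rule Least_le)

lemma gdist_self [simp]: "gdist E i i = 0"
  using gdist_le[of 0 E i i] by simp

locale con_graph =
  fixes n :: nat and E :: "nat \<Rightarrow> nat \<Rightarrow> bool"
  assumes simple: "simple_graph n E" and connected: "connected_graph n E"
begin

lemma adj_less: "E i j \<Longrightarrow> i < n" "E i j \<Longrightarrow> j < n"
  and adj_sym: "E i j \<Longrightarrow> E j i"
  and adj_irrefl [simp]: "\<not> E i i"
  using simple unfolding simple_graph_def by blast+

lemma relpowp_gdist:
  assumes "i < n" "j < n" shows "(E ^^ gdist E i j) i j"
  unfolding gdist_eq_relpowp
  by (rule LeastI_ex) (use assms connected is_walk_iff_relpowp[of E] in \<open>metis connected_graph_def\<close>)

lemma relpowp_sym: "(E ^^ k) i j \<Longrightarrow> (E ^^ k) j i"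
proof (induction k arbitrary: j)
  case (Suc k)
  from Suc.prems obtain y where "(E ^^ k) i y" "E y j" by (rule relpowp_Suc_E)
  then show ?case using relpowp_Suc_I2[OF adj_sym Suc.IH] by simp
qed simp

lemma gdist_sym: "gdist E i j = gdist E j i"
proof -
  have "(\<lambda>k. (E ^^ k) i j) = (\<lambda>k. (E ^^ k) j i)" by (intro ext iffI; erule relpowp_sym)
  then show ?thesis by (simp add: gdist_eq_relpowp)
qed

lemma gdist_adj: "E i j \<Longrightarrow> gdist E i j = 1"
proof -
  assume E: "E i j"
  then have "gdist E i j \<le> 1" using gdist_le[of 1 E i j, unfolded relpowp_1] by simp
  moreover have "gdist E i j \<noteq> 0"
    using relpowp_gdist[OF adj_less[OF E]] E by (intro notI) auto
  ultimately show ?thesis by simp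
qed

lemma gdist_eq_2I:
  assumes "i < n" "j < n" "i \<noteq> j" "\<not> E i j" "gdist E i j \<le> 2"
  shows "gdist E i j = 2"
proof -
  note R = relpowp_gdist[OF assms(1,2)]
  have "gdist E i j \<noteq> 0"
  proof
    assume "gdist E i j = 0"
    then show False using R assms(3) by simp
  qed
  moreover have "gdist E i j \<noteq> 1"
  proof
    assume "gdist E i j = 1"
    with R show False using assms(4) by (metis relpowp_1)
  qed
  ultimately show ?thesis using assms(5) by linarith
qed

text \<open>Entrywise form of D = 2J - 2I - A, on which the trace computations rest.\<close>

lemma gdist_diam2:
  assumes "i < n" "j < n" "gdist E i j \<le> 2"
  shows "real (gdist E i j) = 2 - 2 * of_bool (i = j) - of_bool (E i j)"
proof -
  consider "i = j" | "E i j" | "i \<noteq> j" "\<not> E i j" by blast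
  then show ?thesis
  proof cases
    case 2
    then have "i \<noteq> j" by auto
    then show ?thesis using 2 by (simp add: gdist_adj)
  next
    case 3
    then show ?thesis using gdist_eq_2I[OF assms(1,2) 3 assms(3)] by simp
  qed simp
qed

text \<open>The first four vertices of a shortest walk from i to j: a shortcut between any two of
  them would shorten the whole walk.\<close>

lemma geodesic_P4:
  assumes "i < n" "j < n" "\<not> gdist E i j \<le> 2"
  obtains a b c d where "a < n" "b < n" "c < n" "d < n" "gdist E a b = 1" "gdist E b c = 1" "gdist E c d = 1"
    "gdist E a c = 2" "gdist E b d = 2" "gdist E a d = 3"
proof -
  obtain r where r: "gdist E i j = 3 + r" using assms(3) by (intro that[of "gdist E i j - 3"]) simp
  have "(E ^^ (3 + r)) i j" using relpowp_gdist[OF assms(1,2)] r by simp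
  then obtain d where "(E ^^ 3) i d" and rest: "(E ^^ r) d j"
    by (auto simp: relpowp_add)
  then obtain b c where E: "E i b" "E b c" "E c d"
    unfolding numeral_3_eq_3 by (elim relpowp_Suc_E relpowp_0_E) blast
  \<comment> \<open>A walk from i to d of length below 3, continued by the rest of length r, would
    beat the distance 3 + r. All lower bounds below reduce to this.\<close>
  have short: "3 \<le> q" if "(E ^^ q) i d" for q
    using gdist_le[OF relpowp_trans[OF that rest]] r by simp
  have less: "b < n" "c < n" "d < n" using E adj_less by auto
  have ad: "gdist E i d = 3"
    using short[OF relpowp_gdist[OF assms(1) less(3)]] gdist_le[OF \<open>(E ^^ 3) i d\<close>] by simp
  have "(E ^^ 2) i c" "(E ^^ 2) b d"
    unfolding numeral_2_eq_2 using E by (blast intro: relpowp_Suc_I relpowp_0_I)+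
  note le = this[THEN gdist_le]
  have "2 \<le> gdist E i c"
    using short[OF relpowp_Suc_I[OF relpowp_gdist[OF assms(1) less(2)] E(3)]] by simp
  then have ac: "gdist E i c = 2" using le(1) by simp
  have "2 \<le> gdist E b d"
    using short[OF relpowp_Suc_I2[OF E(1) relpowp_gdist[OF less(1,3)]]] by simp
  then have bd: "gdist E b d = 2" using le(2) by simp
  show thesis by (rule that[OF assms(1) less E[THEN gdist_adj] ac bd ad])
qed

text \<open>A vertex v of maximum degree works. If w is not adjacent to v, a common neighbour u has
  no more neighbours than v, so some neighbour x of v is not adjacent to u, and x, v, u, w is a
  forbidden path. Hypothesis \<open>free\<close> leaves the adjacency of the two ends open and so
  excludes both P4 and C4.\<close>

lemma dominating_vertex:
  assumes n: "0 < n" and diam: "\<And>i j. i < n \<Longrightarrow> j < n \<Longrightarrow> gdist E i j \<le> 2"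
    and free: "\<And>a b c d. E a b \<Longrightarrow> E b c \<Longrightarrow> E c d \<Longrightarrow> \<not> E a c \<Longrightarrow> \<not> E b d \<Longrightarrow> a \<noteq> c \<Longrightarrow> b \<noteq> d \<Longrightarrow> False"
  obtains v where "v < n" "\<And>i. i < n \<Longrightarrow> i \<noteq> v \<Longrightarrow> E v i"
proof -
  let ?N = "\<lambda>v. {u. E v u}"
  have fin: "finite (?N v)" for v
    by (rule finite_subset[of _ "{..<n}"]) (auto dest: adj_less)
  define v where "v = (ARG_MAX (\<lambda>v. card (?N v)) v. v < n)"
  have "card (?N u) \<le> n" for u
    using card_mono[of "{..<n}" "?N u"] by (auto dest: adj_less)
  then have v: "v < n" "\<And>u. u < n \<Longrightarrow> card (?N u) \<le> card (?N v)"
    using arg_max_nat_lemma[of "\<lambda>v. v < n" 0 "\<lambda>v. card (?N v)" "Suc n"] n by (auto simp: v_def less_Suc_eq_le)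
  have "E v w" if w: "w < n" "w \<noteq> v" for w
  proof (rule ccontr)
    assume "\<not> E v w"
    then have "gdist E v w = 2" using gdist_eq_2I[OF v(1) w(1)] diam[OF v(1) w(1)] w(2) by simp
    then have "(E ^^ 2) v w" using relpowp_gdist[OF v(1) w(1)] by simp
    then obtain u where u: "E v u" "E u w"
      unfolding numeral_2_eq_2 by (elim relpowp_Suc_E relpowp_0_E) blast
    \<comment> \<open>Otherwise the neighbours of u include v, w and all neighbours of v other than
      u, one more than the maximum degree.\<close>
    have "\<exists>x. E v x \<and> x \<noteq> u \<and> \<not> E u x"
    proof (rule ccontr)
      assume "\<not> ?thesis"
      then have "insert v (insert w (?N v - {u})) \<subseteq> ?N u" using u(2) adj_sym[OF u(1)] by auto
      then have "card (insert v (insert w (?N v - {u}))) \<le> card (?N u)" by (rule card_mono[OF fin])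
      moreover have "card (insert v (insert w (?N v - {u}))) = Suc (card (?N v))"
        using fin[of v] w \<open>\<not> E v w\<close> card.remove[OF fin[of v], of u] u(1) by simp
      ultimately show False using v(2)[of u] adj_less(2)[OF u(1)] by simp
    qed
    then obtain x where "E v x" "x \<noteq> u" "\<not> E u x" by auto
    then show False using free[of x v u w] u \<open>\<not> E v w\<close> w adj_sym[of v x] adj_sym[of x u] by blast
  qed
  then show thesis using that v(1) by blast
qed

end

section \<open>Traces of the distance matrix for diameter two\<close>

lemma sum_of_bool_delta:
  fixes f :: "nat \<Rightarrow> real"
  shows "(\<Sum>k<n. of_bool (k = j) * f k) = (if j < n then f j else 0)"
    and "(\<Sum>k<n. of_bool (k = j)) = (if j < n then 1 else (0::real))"
  by (simp_all add: of_bool_def if_distrib[of "\<lambda>x. x * _"] cong: if_cong)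

lemma sum_closed_walks:
  fixes f :: "nat \<Rightarrow> nat \<Rightarrow> real"
  shows "(\<Sum>i<n. \<Sum>j<n. \<Sum>k<n. f i j * f j k * f k i) = (\<Sum>i<n. \<Sum>k<n. (\<Sum>j<n. f i j * f j k) * f k i)"
proof (rule sum.cong)
  fix i
  show "(\<Sum>j<n. \<Sum>k<n. f i j * f j k * f k i) = (\<Sum>k<n. (\<Sum>j<n. f i j * f j k) * f k i)"
    by (subst sum.swap) (simp add: sum_distrib_right)
qed simp

text \<open>Expansion of the traces of D^2 and D^3 for D = 2J - 2I - A. The sum of all
  \<open>a i j\<close> is twice the number of edges, the inner sums are the degrees, and the last
  term of the second formula is the trace of A^3.\<close>

lemma diam2_traces:
  fixes a d :: "nat \<Rightarrow> nat \<Rightarrow> real"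
  assumes dist: "\<forall>i<n. \<forall>j<n. d i j = 2 - 2 * of_bool (i = j) - a i j"
    and sym: "\<And>i j. a i j = a j i" and diag: "\<And>i. a i i = 0" and idem: "\<And>i j. a i j * a i j = a i j"
  shows "(\<Sum>i<n. \<Sum>j<n. d i j * d j i) = 4 * real n ^ 2 - 4 * real n - 3 * (\<Sum>i<n. \<Sum>j<n. a i j)" (is ?th1)
    and "(\<Sum>i<n. \<Sum>j<n. \<Sum>k<n. d i j * d j k * d k i) =
      8 * real n ^ 3 - 24 * real n ^ 2 + 16 * real n + (18 - 12 * real n) * (\<Sum>i<n. \<Sum>j<n. a i j)
      + 6 * (\<Sum>i<n. (\<Sum>j<n. a i j)\<^sup>2) - (\<Sum>i<n. \<Sum>j<n. \<Sum>k<n. a i j * a j k * a k i)" (is ?th2)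
proof -
  note d = dist[rule_format]
  define g where "g i = (\<Sum>j<n. a i j)" for i
  define p where "p i k = (\<Sum>j<n. a i j * a j k)" for i k
  have row: "(\<Sum>j<n. a j i) = g i" for i by (simp add: g_def sym)
  have "(\<Sum>i<n. \<Sum>j<n. d i j * d j i) = (\<Sum>i<n. \<Sum>j<n. 4 - 4 * of_bool (j = i) - 3 * a i j)"
  proof (intro sum.cong refl)
    fix i j assume "i \<in> {..<n}" "j \<in> {..<n}"
    then show "d i j * d j i = 4 - 4 * of_bool (j = i) - 3 * a i j"
      using idem[of i j] by (simp add: d sym[of j i] diag algebra_simps)
  qed
  also have "\<dots> = 4 * real n ^ 2 - 4 * real n - 3 * (\<Sum>i<n. \<Sum>j<n. a i j)"
    by (simp add: sum_subtractf sum_distrib_left[symmetric] sum_of_bool_delta power2_eq_square right_diff_distrib)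
  finally show ?th1 .
  have d2: "(\<Sum>j<n. d i j * d j k) = 4 * real n - 8 - 2 * g i - 2 * g k + 4 * of_bool (k = i) + 4 * a i k + p i k"
    if "i < n" "k < n" for i k
  proof -
    have "(\<Sum>j<n. d i j * d j k) = (\<Sum>j<n. 4 - 2 * a i j - 2 * a j k + a i j * a j k
        + of_bool (j = i) * (-4 + 4 * of_bool (k = i) + 2 * a i k) + of_bool (j = k) * (-4 + 2 * a i k))"
      by (intro sum.cong refl) (use that in \<open>auto simp: d diag algebra_simps of_bool_def\<close>)
    also have "\<dots> = 4 * real n - 8 - 2 * g i - 2 * g k + 4 * of_bool (k = i) + 4 * a i k + p i k"
      using that by (simp add: sum.distrib sum_subtractf sum_distrib_left[symmetric] sum_distrib_right[symmetric] row
          g_def[symmetric] p_def[symmetric] sum_of_bool_delta)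
    finally show ?thesis .
  qed
  \<comment> \<open>Walks of length two, counted by their middle vertex.\<close>
  have S2: "(\<Sum>i<n. \<Sum>k<n. p i k) = (\<Sum>i<n. (g i)\<^sup>2)"
  proof -
    have "(\<Sum>i<n. \<Sum>k<n. p i k) = (\<Sum>i<n. \<Sum>j<n. a i j * g j)"
    proof (rule sum.cong)
      fix i
      show "(\<Sum>k<n. p i k) = (\<Sum>j<n. a i j * g j)"
        unfolding p_def by (subst sum.swap) (simp add: sum_distrib_left[symmetric] g_def)
    qed simp
    also have "\<dots> = (\<Sum>j<n. g j * g j)"
      by (subst sum.swap) (simp add: sum_distrib_right[symmetric] row)
    finally show ?thesis by (simp add: power2_eq_square)
  qed
  have gg: "(\<Sum>i<n. \<Sum>k<n. g i * a i k) = (\<Sum>i<n. (g i)\<^sup>2)"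
    by (simp add: sum_distrib_left[symmetric] g_def[symmetric] power2_eq_square)
  have gg': "(\<Sum>i<n. \<Sum>k<n. g k * a i k) = (\<Sum>i<n. (g i)\<^sup>2)"
    by (subst sum.swap) (simp add: sum_distrib_left[symmetric] row power2_eq_square)
  have pp: "p i i = g i" for i unfolding p_def g_def by (intro sum.cong refl) (metis sym idem)
  have "(\<Sum>i<n. \<Sum>j<n. \<Sum>k<n. d i j * d j k * d k i) = (\<Sum>i<n. \<Sum>k<n. (\<Sum>j<n. d i j * d j k) * d k i)"
    by (rule sum_closed_walks)
  \<comment> \<open>The (i, k) entry of D^2 times 2 - 2 [k = i] - \<open>a k i\<close>, grouped into
    constant, degree, diagonal and edge terms; products of \<open>a i k\<close> with itself collapse
    because it is idempotent.\<close>
  also have "\<dots> = (\<Sum>i<n. \<Sum>k<n. (8 * real n - 16) - 4 * g i - 4 * g k + 2 * p i k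
      + of_bool (k = i) * (8 - 8 * real n + 16 + 8 * g i - 8 - 2 * p i i)
      + (8 - 4 - (4 * real n - 8)) * a i k + 2 * (g i * a i k) + 2 * (g k * a i k) - p i k * a k i)"
  proof (intro sum.cong refl)
    fix i k assume "i \<in> {..<n}" "k \<in> {..<n}"
    then show "(\<Sum>j<n. d i j * d j k) * d k i = (8 * real n - 16) - 4 * g i - 4 * g k + 2 * p i k
      + of_bool (k = i) * (8 - 8 * real n + 16 + 8 * g i - 8 - 2 * p i i)
      + (8 - 4 - (4 * real n - 8)) * a i k + 2 * (g i * a i k) + 2 * (g k * a i k) - p i k * a k i"
      unfolding d2[OF \<open>i \<in> {..<n}\<close>[unfolded lessThan_iff] \<open>k \<in> {..<n}\<close>[unfolded lessThan_iff]]
      using idem[of i k] by (cases "k = i") (simp_all add: d sym[of k i] diag algebra_simps)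
  qed
  also have "\<dots> = 8 * real n ^ 3 - 24 * real n ^ 2 + 16 * real n + (18 - 12 * real n) * (\<Sum>i<n. g i)
      + 6 * (\<Sum>i<n. (g i)\<^sup>2) - (\<Sum>i<n. \<Sum>k<n. p i k * a k i)"
    unfolding sum.distrib sum_subtractf
    by (simp add: sum_distrib_left[symmetric] S2 gg gg' pp g_def[symmetric] sum_of_bool_delta sum.distrib
        sum_subtractf) (simp add: power2_eq_square power3_eq_cube algebra_simps)
  also have "(\<Sum>i<n. \<Sum>k<n. p i k * a k i) = (\<Sum>i<n. \<Sum>j<n. \<Sum>k<n. a i j * a j k * a k i)"
    unfolding p_def by (rule sum_closed_walks[symmetric])
  finally show ?th2 by (simp add: g_def)
qed

text \<open>Closed 3-walks starting at v correspond to ordered edges avoiding v, since every other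
  vertex is adjacent to v. Of all ordered edges, exactly 2(n - 1) meet v.\<close>

lemma triangles_dominating:
  fixes a :: "nat \<Rightarrow> nat \<Rightarrow> real"
  assumes v: "v < n" and row: "\<forall>j<n. a v j = 1 - of_bool (j = v)" and sym: "\<And>i j. a i j = a j i"
  shows "(\<Sum>i<n. \<Sum>j<n. \<Sum>k<n. a i j * a j k * a k i) =
    (\<Sum>i\<in>{..<n} - {v}. \<Sum>j<n. \<Sum>k<n. a i j * a j k * a k i) + (\<Sum>i<n. \<Sum>j<n. a i j) - 2 * (real n - 1)"
proof -
  have av: "(\<Sum>j<n. a v j) = real n - 1"
    using v row by (simp add: sum_subtractf sum_of_bool_delta)
  have col: "(\<Sum>j<n. a j v) = (\<Sum>j<n. a v j)" by (intro sum.cong refl sym)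
  have "(\<Sum>j<n. \<Sum>k<n. a v j * a j k * a k v) =
     (\<Sum>j<n. \<Sum>k<n. a j k - of_bool (j = v) * a v k - of_bool (k = v) * a j v + of_bool (j = v) * (of_bool (k = v) * a v v))"
  proof (intro sum.cong refl)
    fix j k assume "j \<in> {..<n}" "k \<in> {..<n}"
    then have "a v j = 1 - of_bool (j = v)" "a k v = 1 - of_bool (k = v)"
      using row sym[of k v] by simp_all
    then show "a v j * a j k * a k v =
        a j k - of_bool (j = v) * a v k - of_bool (k = v) * a j v + of_bool (j = v) * (of_bool (k = v) * a v v)"
      by (cases "j = v"; cases "k = v") simp_all
  qed
  also have "\<dots> = (\<Sum>i<n. \<Sum>j<n. a i j) - (\<Sum>j<n. a v j) - (\<Sum>j<n. a j v) + a v v"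
    using v row by (simp add: sum.distrib sum_subtractf sum_distrib_left[symmetric] sum_of_bool_delta)
  finally have "(\<Sum>j<n. \<Sum>k<n. a v j * a j k * a k v) = (\<Sum>i<n. \<Sum>j<n. a i j) - 2 * (real n - 1)"
    using row v av col by simp
  then show ?thesis using v row by (simp add: sum.remove[of "{..<n}" v])
qed

text \<open>Each closed 3-walk at i picks an ordered pair of distinct neighbours of i.\<close>

lemma triangles_at_vertex_le:
  fixes a :: "nat \<Rightarrow> nat \<Rightarrow> real"
  assumes sym: "\<And>i j. a i j = a j i" and diag: "\<And>i. a i i = 0" and vals: "\<And>i j. a i j \<in> {0, 1}"
  shows "(\<Sum>j<n. \<Sum>k<n. a i j * a j k * a k i) \<le> (\<Sum>j<n. a i j)\<^sup>2 - (\<Sum>j<n. a i j)"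
proof -
  have "(\<Sum>j<n. \<Sum>k<n. a i j * a j k * a k i) \<le> (\<Sum>j<n. \<Sum>k<n. a i j * a i k - of_bool (k = j) * a i j)"
  proof (intro sum_mono)
    fix j k
    show "a i j * a j k * a k i \<le> a i j * a i k - of_bool (k = j) * a i j"
      unfolding sym[of k i] using vals[of i j] vals[of j k] vals[of i k] diag[of j] by auto
  qed
  also have "\<dots> = (\<Sum>j<n. a i j)\<^sup>2 - (\<Sum>j<n. a i j)"
    unfolding power2_eq_square sum_product sum_subtractf by (simp add: sum_of_bool_delta)
  finally show ?thesis .
qed

section \<open>The friendship graph\<close>

text \<open>On 1, ..., 2k this is the involution exchanging 2t-1 and 2t, the two outer vertices of
  one triangle.\<close>

definition mate :: "nat \<Rightarrow> nat" where "mate i = (if odd i then i + 1 else i - 1)"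

lemma mate:
  assumes "i \<in> {..<2*k+1} - {0}"
  shows "mate i \<in> {..<2*k+1} - {0}" "mate (mate i) = i" "mate i \<noteq> i"
  using assms by (auto simp: mate_def elim!: oddE evenE)

lemma friendship_0: "friendship_graph k 0 j \<longleftrightarrow> j < 2*k+1 \<and> j \<noteq> 0"
  by (auto simp: friendship_graph_def)

lemma friendship_nonzero:
  assumes "i \<in> {..<2*k+1} - {0}"
  shows "friendship_graph k i j \<longleftrightarrow> j = 0 \<or> j = mate i"
proof -
  have "(i + 1) div 2 = (j + 1) div 2 \<longleftrightarrow> j = i \<or> j = mate i" if "j \<noteq> 0"
    using assms that unfolding mate_def by auto presburger+
  then show ?thesis
    using assms mate[OF assms] by (auto simp: friendship_graph_def)
qed

lemma friendship_con_graph: "con_graph (2*k+1) (friendship_graph k)"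
  and friendship_diam: "i < 2*k+1 \<Longrightarrow> j < 2*k+1 \<Longrightarrow> gdist (friendship_graph k) i j \<le> 2"
proof -
  let ?F = "friendship_graph k"
  have sym: "?F i j \<Longrightarrow> ?F j i" for i j unfolding friendship_graph_def by metis
  have walk: "\<exists>q\<le>2. (?F ^^ q) i j" if ij: "i < 2*k+1" "j < 2*k+1" for i j
  proof -
    have centre: "?F 0 l" "?F l 0" if "l < 2*k+1" "l \<noteq> 0" for l
      using that sym[of 0 l] by (simp_all add: friendship_0)
    consider "i = j" | "?F i j" | "?F i 0" "?F 0 j"
      using ij centre[of i] centre[of j] by metis
    then show ?thesis
    proof cases
      case 1 then show ?thesis by (intro exI[of _ 0]) simp
    next
      case 2 then show ?thesis by (intro exI[of _ 1] conjI) (simp, unfold relpowp_1)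
    next
      case 3
      have "(?F ^^ 2) i j"
        using relpowp_Suc_I[of "Suc 0" ?F i 0 j] 3 unfolding numeral_2_eq_2 relpowp_Suc_0 by blast
      then show ?thesis by blast
    qed
  qed
  show "gdist ?F i j \<le> 2" if "i < 2*k+1" "j < 2*k+1"
    using walk[OF that] gdist_le order.trans by blast
  show "con_graph (2*k+1) ?F"
  proof
    show "simple_graph (2*k+1) ?F" unfolding simple_graph_def
    proof (intro conjI)
      show "\<forall>i j. ?F i j \<longrightarrow> ?F j i" using sym by blast
    qed (auto simp: friendship_graph_def)
    show "connected_graph (2*k+1) ?F"
      unfolding connected_graph_def using walk is_walk_iff_relpowp[of ?F] by metis
  qed
qed

lemma friendship_row_sum:
  fixes x :: "nat \<Rightarrow> real"
  shows "(\<Sum>j<2*k+1. of_bool (friendship_graph k 0 j) * x j) = (\<Sum>j\<in>{..<2*k+1} - {0}. x j)"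
    and "i \<in> {..<2*k+1} - {0} \<Longrightarrow> (\<Sum>j<2*k+1. of_bool (friendship_graph k i j) * x j) = x 0 + x (mate i)"
proof -
  show "(\<Sum>j<2*k+1. of_bool (friendship_graph k 0 j) * x j) = (\<Sum>j\<in>{..<2*k+1} - {0}. x j)"
    by (rule sum.mono_neutral_cong_right) (auto simp: friendship_0)
  assume i: "i \<in> {..<2*k+1} - {0}"
  have "(\<Sum>j<2*k+1. of_bool (friendship_graph k i j) * x j) = (\<Sum>j\<in>{0, mate i}. x j)"
    by (rule sum.mono_neutral_cong_right) (use mate[OF i] friendship_nonzero[OF i] in auto)
  then show "(\<Sum>j<2*k+1. of_bool (friendship_graph k i j) * x j) = x 0 + x (mate i)"
    using mate[OF i] by simp
qed

text \<open>With S, N and R the sums of x_i, x_i^2 and x_i x_(mate i) over the outer vertices, the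
  form is 2 x_0 S + 2 S^2 - 2N - R, and |R| is at most N. Both bounds are read off from
  this.\<close>

lemma friendship_quad:
  fixes x :: "nat \<Rightarrow> real" and k :: nat
  defines "d \<equiv> \<lambda>i j. real (gdist (friendship_graph k) i j)"
  shows "0 \<le> quad (2*k+1) d x + 3 * (\<Sum>i<2*k+1. (x i)\<^sup>2)"
    and "(\<Sum>i<2*k+1. (if i = 0 then 1 else 2) * x i) = 0 \<Longrightarrow> quad (2*k+1) d x + 1/2 * (\<Sum>i<2*k+1. (x i)\<^sup>2) \<le> 0"
proof -
  interpret con_graph "2*k+1" "friendship_graph k" by (rule friendship_con_graph)
  let ?n = "2*k+1" and ?V = "{..<2*k+1} - {0}"
  define S where "S = (\<Sum>i\<in>?V. x i)"
  define N where "N = (\<Sum>i\<in>?V. (x i)\<^sup>2)"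
  define R where "R = (\<Sum>i\<in>?V. x i * x (mate i))"
  have split: "(\<Sum>i<?n. g i) = g 0 + (\<Sum>i\<in>?V. g i)" for g :: "nat \<Rightarrow> real"
    by (rule sum.remove) auto
  have total: "(\<Sum>i<?n. x i) = x 0 + S" unfolding split S_def ..
  have d: "d i j = 2 - 2 * of_bool (i = j) - of_bool (friendship_graph k i j)" if "i < ?n" "j < ?n" for i j
    using gdist_diam2[OF that friendship_diam[OF that]] by (simp add: d_def)
  have row: "(\<Sum>j<?n. d i j * x i * x j) = x i * (2 * (\<Sum>j<?n. x j) - 2 * x i - (\<Sum>j<?n. of_bool (friendship_graph k i j) * x j))"
    if "i < ?n" for i
  proof -
    have "(\<Sum>j<?n. d i j * x i * x j) = (\<Sum>j<?n. x i * (2 * x j - 2 * (of_bool (j = i) * x j) - of_bool (friendship_graph k i j) * x j))"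
    proof (intro sum.cong refl)
      fix j assume "j \<in> {..<?n}"
      then have "j < ?n" by simp
      show "d i j * x i * x j = x i * (2 * x j - 2 * (of_bool (j = i) * x j) - of_bool (friendship_graph k i j) * x j)"
        unfolding d[OF that \<open>j < ?n\<close>] by (simp add: algebra_simps)
    qed
    also have "\<dots> = x i * (2 * (\<Sum>j<?n. x j) - 2 * x i - (\<Sum>j<?n. of_bool (friendship_graph k i j) * x j))"
      using that by (simp only: sum_distrib_left[symmetric] sum_subtractf sum_of_bool_delta) simp
    finally show ?thesis .
  qed
  have "quad ?n d x = (\<Sum>i<?n. x i * (2 * (\<Sum>j<?n. x j) - 2 * x i - (\<Sum>j<?n. of_bool (friendship_graph k i j) * x j)))"
    unfolding quad_def by (intro sum.cong refl row) simp
  also have "\<dots> = x 0 * (2 * (x 0 + S) - 2 * x 0 - S) + (\<Sum>i\<in>?V. x i * (2 * (x 0 + S) - 2 * x i - (x 0 + x (mate i))))"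
    unfolding total
    by (subst split, intro arg_cong2[of _ _ _ _ "(+)"] sum.cong)
      (simp_all only: friendship_row_sum S_def)
  also have "(\<Sum>i\<in>?V. x i * (2 * (x 0 + S) - 2 * x i - (x 0 + x (mate i)))) = (\<Sum>i\<in>?V. (x 0 + 2 * S) * x i - 2 * (x i)\<^sup>2 - x i * x (mate i))"
    by (intro sum.cong refl) (simp add: algebra_simps power2_eq_square)
  also have "\<dots> = (x 0 + 2 * S) * S - 2 * N - R"
    by (simp only: sum_subtractf sum_distrib_left[symmetric] S_def N_def R_def)
  finally have Q: "quad ?n d x = 2 * x 0 * S + 2 * S\<^sup>2 - 2 * N - R"
    by (simp add: algebra_simps power2_eq_square)
  have "bij_betw mate ?V ?V"
    by (intro bij_betw_byWitness[of _ mate] ballI image_subsetI) (rule mate, assumption)+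
  then have mateN: "(\<Sum>i\<in>?V. (x (mate i))\<^sup>2) = N"
    unfolding N_def by (rule sum.reindex_bij_betw)
  \<comment> \<open>These sums of squares equal 2N + 2R and 2N - 2R, which bounds R on both
    sides.\<close>
  have "0 \<le> (\<Sum>i\<in>?V. (x i + x (mate i))\<^sup>2)" "0 \<le> (\<Sum>i\<in>?V. (x i - x (mate i))\<^sup>2)"
    by (intro sum_nonneg; simp)+
  moreover have "(\<Sum>i\<in>?V. (x i + x (mate i))\<^sup>2) = N + N + 2 * R"
    unfolding power2_sum sum.distrib mateN by (simp add: N_def R_def sum_distrib_left ac_simps)
  moreover have "(\<Sum>i\<in>?V. (x i - x (mate i))\<^sup>2) = N + N - 2 * R"
    unfolding power2_diff sum.distrib sum_subtractf mateN by (simp add: N_def R_def sum_distrib_left ac_simps)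
  ultimately have NR: "- N \<le> R" "R \<le> N" by linarith+
  have norm: "(\<Sum>i<?n. (x i)\<^sup>2) = (x 0)\<^sup>2 + N" unfolding split N_def ..
  \<comment> \<open>This is 3 x_0^2 + 2 x_0 S + 2 S^2; adding N - R gives the form plus 3
    |x|^2.\<close>
  have "0 \<le> 2 * (x 0)\<^sup>2 + (x 0 + S)\<^sup>2 + S\<^sup>2" by simp
  then show "0 \<le> quad ?n d x + 3 * (\<Sum>i<?n. (x i)\<^sup>2)"
    unfolding Q norm using NR by (simp add: power2_sum)
  assume "(\<Sum>i<?n. (if i = 0 then 1 else 2) * x i) = 0"
  \<comment> \<open>On this hyperplane the form becomes -2 S^2 - 2N - R, and the term 2 S^2 coming
    from x_0^2 / 2 cancels exactly.\<close>
  then have "x 0 = - 2 * S" unfolding split by (simp add: S_def sum_distrib_left[symmetric])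
  moreover have "0 \<le> N" unfolding N_def by (intro sum_nonneg) simp
  ultimately show "quad ?n d x + 1/2 * (\<Sum>i<?n. (x i)\<^sup>2) \<le> 0"
    unfolding Q norm using NR by (simp add: power2_eq_square add_divide_distrib)
qed

text \<open>Induction removing one matched pair, which receives the labels 2k+1 and 2k+2. The block
  number (label + 1) div 2 is k+1 for both, in agreement with
  \<open>friendship_graph\<close>.\<close>

lemma perfect_matching_labelling:
  assumes "finite S" "card S = 2 * k" "\<And>i j. E i j \<Longrightarrow> E j i" "\<And>i. \<not> E i i"
    and "\<And>i. i \<in> S \<Longrightarrow> \<exists>!j. j \<in> S \<and> E i j"
  shows "\<exists>f. bij_betw f S {1..2*k} \<and>
    (\<forall>i\<in>S. \<forall>j\<in>S. E i j \<longleftrightarrow> i \<noteq> j \<and> (f i + 1) div 2 = (f j + 1) div (2::nat))"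
  using assms(1,2,5)
proof (induction k arbitrary: S)
  case 0
  then show ?case by (auto simp: bij_betw_def)
next
  case (Suc k)
  note sym = assms(3) and irrefl = assms(4)
  obtain a where a: "a \<in> S" using Suc.prems(2) by fastforce
  obtain b where b: "b \<in> S" "E a b" and b_uniq: "\<And>j. j \<in> S \<Longrightarrow> E a j \<Longrightarrow> j = b" using Suc.prems(3)[OF a] by blast
  have a_uniq: "j = a" if "j \<in> S" "E b j" for j using Suc.prems(3)[OF b(1)] a sym[OF b(2)] that by blast
  have ab: "a \<noteq> b" using b irrefl by auto
  let ?S = "S - {a, b}"
  have "card ?S = 2 * k" using Suc.prems(1,2) a b ab by (simp add: card_Diff_subset)
  moreover have "\<exists>!j. j \<in> ?S \<and> E i j" if "i \<in> ?S" for i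
  proof -
    obtain j where j: "j \<in> S" "E i j" "\<And>l. l \<in> S \<Longrightarrow> E i l \<Longrightarrow> l = j" using Suc.prems(3)[of i] \<open>i \<in> ?S\<close> by blast
    moreover have "j \<noteq> a" "j \<noteq> b" using j(2) b_uniq[of i] a_uniq[of i] sym that by blast+
    ultimately show ?thesis by blast
  qed
  ultimately obtain f where f: "bij_betw f ?S {1..2*k}"
    "\<And>i j. i \<in> ?S \<Longrightarrow> j \<in> ?S \<Longrightarrow> E i j \<longleftrightarrow> i \<noteq> j \<and> (f i + 1) div 2 = (f j + 1) div 2"
    using Suc.IH[of ?S] Suc.prems(1) by auto
  define g where "g = f(a := 2*k+1, b := 2*k+2)"
  have ga: "g a = 2*k+1" "g b = 2*k+2" using ab by (simp_all add: g_def)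
  have gf: "g i = f i" if "i \<in> ?S" for i using that by (auto simp: g_def)
  have "bij_betw g ?S {1..2*k}" using f(1) bij_betw_cong[of ?S g f] gf by blast
  moreover have "bij_betw g {a, b} {2*k+1, 2*k+2}" using ab ga by (auto simp: bij_betw_def)
  ultimately have "bij_betw g (?S \<union> {a, b}) ({1..2*k} \<union> {2*k+1, 2*k+2})"
    by (rule bij_betw_combine) auto
  moreover have "?S \<union> {a, b} = S" using a b by auto
  moreover have "{1..2*k} \<union> {2*k+1, 2*k+2} = {1..2 * Suc k}" by auto
  ultimately have "bij_betw g S {1..2 * Suc k}" by simp
  moreover have "E i j \<longleftrightarrow> i \<noteq> j \<and> (g i + 1) div 2 = (g j + 1) div 2" if ij: "i \<in> S" "j \<in> S" for i j
  proof -
    \<comment> \<open>The vertices left after removal stay in blocks up to k and never share the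
      block of a and b.\<close>
    have low: "(g l + 1) div 2 \<le> k" if "l \<in> ?S" for l
    proof -
      have "f l \<le> 2 * k" using bij_betwE[OF f(1)] that by auto
      then show ?thesis using gf[OF that] by linarith
    qed
    have E_ab: "E a b" "E b a" using b sym by auto
    have no: "\<not> E a l" "\<not> E b l" "\<not> E l a" "\<not> E l b" if "l \<in> ?S" for l
      using that b_uniq a_uniq sym by blast+
    consider "i \<in> ?S" "j \<in> ?S" | "i \<in> ?S" "j \<in> {a, b}" | "i \<in> {a, b}" "j \<in> ?S" | "i \<in> {a, b}" "j \<in> {a, b}"
      using ij by blast
    then show ?thesis
    proof cases
      case 1 then show ?thesis using f(2) gf by simp
    next
      case 2
      then have "\<not> E i j" "(g j + 1) div 2 = k + 1" using no ga by auto
      then show ?thesis using low[OF 2(1)] by simp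
    next
      case 3
      then have "\<not> E i j" "(g i + 1) div 2 = k + 1" using no ga by auto
      then show ?thesis using low[OF 3(2)] by simp
    next
      case 4
      then show ?thesis using E_ab irrefl ga ab by auto
    qed
  qed
  ultimately show ?case by blast
qed

text \<open>Deleting the dominating vertex lowers every other degree from 2 to 1, so a perfect
  matching remains; it is labelled by 1, ..., 2k and v by 0.\<close>

lemma graph_iso_friendshipI:
  assumes "con_graph (2*k+1) G" and v: "v < 2*k+1" "\<And>i. i < 2*k+1 \<Longrightarrow> i \<noteq> v \<Longrightarrow> G v i"
    and deg: "\<And>i. i < 2*k+1 \<Longrightarrow> i \<noteq> v \<Longrightarrow> card {j. G i j} = 2"
  shows "graph_iso (2*k+1) G (2*k+1) (friendship_graph k)"
proof -
  interpret con_graph "2*k+1" G by fact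
  let ?V = "{..<2*k+1} - {v}"
  have partner: "\<exists>!j. j \<in> ?V \<and> G i j" if "i \<in> ?V" for i
  proof -
    have "{j. G i j} = insert v {j. j \<in> ?V \<and> G i j}"
      using that v(2)[of i] adj_sym[of v i] adj_less(2)[of i] by auto
    then have "card (insert v {j. j \<in> ?V \<and> G i j}) = 2" using deg[of i] that by simp
    then have "card {j. j \<in> ?V \<and> G i j} = 1" by (subst (asm) card_insert_disjoint) auto
    then obtain j where "{j. j \<in> ?V \<and> G i j} = {j}" by (auto simp: card_1_singleton_iff)
    then have "l \<in> ?V \<and> G i l \<longleftrightarrow> l = j" for l by (simp add: set_eq_iff)
    then show ?thesis by (intro ex1I[of _ j]) simp_all
  qed
  have card: "card ?V = 2 * k" using v(1) by simp
  have "\<exists>f. bij_betw f ?V {1..2*k} \<and> (\<forall>i\<in>?V. \<forall>j\<in>?V. G i j \<longleftrightarrow> i \<noteq> j \<and> (f i + 1) div 2 = (f j + 1) div 2)"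
    by (rule perfect_matching_labelling[OF _ card adj_sym adj_irrefl partner]) simp_all
  then obtain f where f: "bij_betw f ?V {1..2*k}"
    "\<And>i j. i \<in> ?V \<Longrightarrow> j \<in> ?V \<Longrightarrow> G i j \<longleftrightarrow> i \<noteq> j \<and> (f i + 1) div 2 = (f j + 1) div 2" by blast
  define g where "g = f(v := 0)"
  have gf: "g i = f i" if "i \<in> ?V" for i using that by (simp add: g_def)
  have gv: "g v = 0" by (simp add: g_def)
  have "bij_betw g ?V {1..2*k}" using f(1) bij_betw_cong[of ?V g f] gf by blast
  moreover have "bij_betw g {v} {0}" by (simp add: bij_betw_def gv)
  ultimately have "bij_betw g (?V \<union> {v}) ({1..2*k} \<union> {0})" by (rule bij_betw_combine) auto
  moreover have "?V \<union> {v} = {..<2*k+1}" using v(1) by auto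
  moreover have "{1..2*k} \<union> {0} = {..<2*k+1}" by auto
  ultimately have bij: "bij_betw g {..<2*k+1} {..<2*k+1}" by simp
  have range: "g i \<in> {1..2*k}" if "i \<in> ?V" for i using bij_betwE[OF f(1)] gf[OF that] that by auto
  have inj: "g i = g j \<longleftrightarrow> i = j" if "i < 2*k+1" "j < 2*k+1" for i j
    using bij that by (auto simp: bij_betw_def inj_on_def)
  have "G i j \<longleftrightarrow> friendship_graph k (g i) (g j)" if ij: "i < 2*k+1" "j < 2*k+1" for i j
  proof -
    consider "i = v" "j = v" | "i = v" "j \<in> ?V" | "i \<in> ?V" "j = v" | "i \<in> ?V" "j \<in> ?V" using ij by blast
    then show ?thesis
    proof cases
      case 1 then show ?thesis by (simp add: friendship_graph_def)
    next
      case 2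
      then show ?thesis using range[OF 2(2)] v(2)[of j] by (simp add: gv friendship_graph_def)
    next
      case 3
      then show ?thesis using range[OF 3(1)] v(2)[of i] adj_sym[of v i] by (simp add: gv friendship_graph_def)
    next
      case 4
      then have "G i j \<longleftrightarrow> g i \<noteq> g j \<and> (g i + 1) div 2 = (g j + 1) div 2"
        using f(2)[OF 4] gf[OF 4(1)] gf[OF 4(2)] inj[OF ij] by simp
      then show ?thesis using range[OF 4(1)] range[OF 4(2)] by (simp add: friendship_graph_def)
    qed
  qed
  then show ?thesis unfolding graph_iso_def using bij by blast
qed

section \<open>Cospectral graphs\<close>

text \<open>Evaluates test vectors supported on four vertices, which reduces the form to a 4 by 4
  principal submatrix.\<close>

lemma four_point_vector:
  fixes \<delta> :: "nat \<Rightarrow> nat \<Rightarrow> real" and p q r s :: real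
  assumes dist: "distinct [a, b, c, d]" and less: "a < n" "b < n" "c < n" "d < n"
    and sym: "\<And>i j. \<delta> i j = \<delta> j i" and diag: "\<And>i. \<delta> i i = 0"
  defines "x \<equiv> \<lambda>i. if i = a then p else if i = b then q else if i = c then r else if i = d then s else 0"
  shows "quad n \<delta> x = 2 * (\<delta> a b * p * q + \<delta> a c * p * r + \<delta> a d * p * s + \<delta> b c * q * r + \<delta> b d * q * s + \<delta> c d * r * s)"
    and "(\<Sum>i<n. (x i)\<^sup>2) = p\<^sup>2 + q\<^sup>2 + r\<^sup>2 + s\<^sup>2"
    and "(\<Sum>i<n. w i * x i) = w a * p + w b * q + w c * r + w d * s"
proof -
  let ?S = "{a, b, c, d}"
  have restrict: "(\<Sum>i<n. g i) = g a + g b + g c + g d" if "\<And>i. i \<notin> ?S \<Longrightarrow> g i = 0" for g :: "nat \<Rightarrow> real"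
  proof -
    have "(\<Sum>i<n. g i) = (\<Sum>i\<in>?S. g i)"
      using less that by (intro sum.mono_neutral_right) auto
    then show ?thesis using dist by (simp add: add.assoc)
  qed
  have x: "x a = p" "x b = q" "x c = r" "x d = s" "\<And>i. i \<notin> ?S \<Longrightarrow> x i = 0"
    using dist by (auto simp: x_def)
  have inner: "(\<Sum>j<n. \<delta> i j * x i * x j) = x i * (\<delta> i a * p + \<delta> i b * q + \<delta> i c * r + \<delta> i d * s)" for i
    by (subst restrict) (simp_all add: x algebra_simps)
  show "quad n \<delta> x = 2 * (\<delta> a b * p * q + \<delta> a c * p * r + \<delta> a d * p * s + \<delta> b c * q * r + \<delta> b d * q * s + \<delta> c d * r * s)"
    unfolding quad_def inner
    by (subst restrict) (simp_all add: x diag sym[of b a] sym[of c a] sym[of d a] sym[of c b] sym[of d b] sym[of d c] algebra_simps)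
  show "(\<Sum>i<n. (x i)\<^sup>2) = p\<^sup>2 + q\<^sup>2 + r\<^sup>2 + s\<^sup>2"
    by (subst restrict) (simp_all add: x)
  show "(\<Sum>i<n. w i * x i) = w a * p + w b * q + w c * r + w d * s"
    by (subst restrict) (simp_all add: x)
qed

lemma linear_form_kernel:
  obtains \<alpha> \<beta> :: real where "\<alpha> * A + \<beta> * B = 0" "\<alpha> \<noteq> 0 \<or> \<beta> \<noteq> 0"
proof (cases "A = 0")
  case True
  then show thesis using that[of 1 0] by simp
next
  case False
  then show thesis using that[of "- B" A] by simp
qed

text \<open>The number of roots with multiplicity is the order of the graph, and a monic complex
  polynomial is determined by its root multiset.\<close>

lemma char_poly_eq_if_D_cospectral:
  assumes "D_cospectral m G n H"
  shows "m = n" and "char_poly (map_mat complex_of_real (distance_matrix m G)) =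
    char_poly (map_mat complex_of_real (distance_matrix n H))"
proof -
  let ?p = "\<lambda>m G. char_poly (map_mat complex_of_real (distance_matrix m G))"
  have carrier: "map_mat complex_of_real (distance_matrix m G) \<in> carrier_mat m m" for m G
    by (simp add: distance_matrix_def)
  have deg: "degree (?p m G) = m" and monic: "lead_coeff (?p m G) = 1" for m G
    using degree_monic_char_poly[OF carrier] by simp_all
  have roots: "proots (?p m G) = proots (?p n H)"
    using assms by (simp add: D_cospectral_def D_spectrum_def)
  show "m = n" using arg_cong[OF roots, of size] by (simp only: size_proots_complex deg)
  show "?p m G = ?p n H"
    using complex_poly_decompose_multiset[of "?p m G"] complex_poly_decompose_multiset[of "?p n H"]
    by (simp add: monic roots)
qed

lemma (in con_graph) sum_adj_eq_card: "(\<Sum>j<n. of_bool (E i j)) = real (card {j. E i j})"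
proof -
  have "{..<n} \<inter> {j. E i j} = {j. E i j}" using adj_less by auto
  then show ?thesis by simp
qed

theorem theorem3p6:
  fixes k n m :: nat and G :: "nat \<Rightarrow> nat \<Rightarrow> bool"
  assumes "k \<ge> 2" and "n = 2*k+1"
    and "simple_graph m G" and "connected_graph m G"
    and "D_cospectral m G n (friendship_graph k)"
  shows "graph_iso m G n (friendship_graph k)"
proof -
  let ?F = "friendship_graph k"
  have mn: "m = n" using char_poly_eq_if_D_cospectral[OF assms(5)] by simp
  have con: "con_graph n G" using assms(3,4) mn by (simp add: con_graph_def)
  interpret G: con_graph n G by (rule con)
  interpret F: con_graph n ?F using friendship_con_graph assms(2) by simp
  have n: "0 < n" using assms(2) by simp
  define d where "d = (\<lambda>i j. real (gdist G i j))"
  define d' where "d' = (\<lambda>i j. real (gdist ?F i j))"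
  have sym: "d i j = d j i" "d' i j = d' j i" for i j by (simp_all add: d_def d'_def G.gdist_sym F.gdist_sym)
  have diag: "d i i = 0" for i by (simp add: d_def)
  have mats: "distance_matrix m G = mat n n (\<lambda>(i, j). d i j)" "distance_matrix n ?F = mat n n (\<lambda>(i, j). d' i j)"
    by (simp_all add: distance_matrix_def d_def d'_def mn)
  obtain w where w: "\<And>x. quad n d x = quad n d' (\<lambda>i. \<Sum>j<n. w i j * x j)"
    and norm: "\<And>x. (\<Sum>i<n. (\<Sum>j<n. w i j * x j)\<^sup>2) = (\<Sum>i<n. (x i)\<^sup>2)"
    and tr2: "(\<Sum>i<n. \<Sum>j<n. d i j * d j i) = (\<Sum>i<n. \<Sum>j<n. d' i j * d' j i)"
    and tr3: "(\<Sum>i<n. \<Sum>j<n. \<Sum>k<n. d i j * d j k * d k i) = (\<Sum>i<n. \<Sum>j<n. \<Sum>k<n. d' i j * d' j k * d' k i)"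
    by (rule cospectral_isometry[OF sym char_poly_eq_if_D_cospectral(2)[OF assms(5), unfolded mats]]) (rule that)
  note fq = friendship_quad[where k = k, folded assms(2) d'_def]
  have lower: "0 \<le> quad n d x + 3 * (\<Sum>i<n. (x i)\<^sup>2)" for x
    unfolding w norm[of x, symmetric] by (rule fq(1))
  \<comment> \<open>Normal vector of the hyperplane of \<open>friendship_quad\<close>, pulled back
    along \<open>w\<close>; the weights 1 and 2 are those of centre and outer vertices.\<close>
  define c where "c j = (\<Sum>i<n. (if i = 0 then 1 else 2) * w i j)" for j
  have upper: "quad n d x + 1/2 * (\<Sum>i<n. (x i)\<^sup>2) \<le> 0" if "(\<Sum>j<n. c j * x j) = 0" for x
    unfolding w norm[of x, symmetric]
  proof (rule fq(2))
    have "(\<Sum>i<n. (if i = 0 then 1 else 2) * (\<Sum>j<n. w i j * x j)) = (\<Sum>i<n. \<Sum>j<n. (if i = 0 then 1 else 2) * w i j * x j)"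
      by (simp only: sum_distrib_left mult.assoc)
    also have "\<dots> = (\<Sum>j<n. c j * x j)"
      unfolding c_def sum_distrib_right by (rule sum.swap)
    finally show "(\<Sum>i<n. (if i = 0 then 1 else 2) * (\<Sum>j<n. w i j * x j)) = 0" using that by simp
  qed

  \<comment> \<open>Excluding diameter three and induced P4 and C4\<close>
  have diam: "gdist G i j \<le> 2" if "i < n" "j < n" for i j
  proof (rule ccontr)
    assume "\<not> gdist G i j \<le> 2"
    then obtain a b c e where P: "a < n" "b < n" "c < n" "e < n" "gdist G a b = 1" "gdist G b c = 1" "gdist G c e = 1"
      "gdist G a c = 2" "gdist G b e = 2" "gdist G a e = 3"
      using G.geodesic_P4 \<open>i < n\<close> \<open>j < n\<close> by blast
    have "distinct [a, b, c, e]" using P(5-) by auto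
    \<comment> \<open>An integer approximation to the eigenvector for -2 - sqrt 2: the form takes
      the value -34 and the squared norm is 10, so -34 + 30 violates \<open>lower\<close>.\<close>
    note fp = four_point_vector[OF this P(1-4) sym(1) diag, where p = 2 and q = 1 and r = "-1" and s = "-2"]
    show False
      using lower[of "\<lambda>i. if i = a then 2 else if i = b then 1 else if i = c then -1 else if i = e then -2 else 0"]
      unfolding fp using P(5-) by (simp add: d_def)
  qed
  have d: "d i j = 2 - 2 * of_bool (i = j) - of_bool (G i j)" if "i < n" "j < n" for i j
    using G.gdist_diam2[OF that diam[OF that]] by (simp add: d_def)
  have free: "False" if P: "G a b" "G b c0" "G c0 e" "\<not> G a c0" "\<not> G b e" "a \<noteq> c0" "b \<noteq> e" for a b c0 e
  proof -
    have less: "a < n" "b < n" "c0 < n" "e < n" using P(1-3) G.adj_less by blast+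
    have ae: "a \<noteq> e" using P(3,4) G.adj_sym by blast
    have dist: "distinct [a, b, c0, e]" using P ae by auto
    \<comment> \<open>The ends a and e are adjacent for C4 and at distance 2 for P4.\<close>
    have dd: "d a b = 1" "d b c0 = 1" "d c0 e = 1" "d a c0 = 2" "d b e = 2" "d a e = (if G a e then 1 else 2)"
      using P ae less dist by (simp_all add: d)
    \<comment> \<open>The plane spanned by the all-ones vector and \<open>(p, q, r, s)\<close> meets the hyperplane.\<close>
    have plane: "\<exists>\<alpha> \<beta>. (\<alpha> \<noteq> 0 \<or> \<beta> \<noteq> 0) \<and>
        2 * ((\<alpha> + \<beta> * p) * (\<alpha> + \<beta> * q) + 2 * (\<alpha> + \<beta> * p) * (\<alpha> + \<beta> * r) + d a e * (\<alpha> + \<beta> * p) * (\<alpha> + \<beta> * s)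
          + (\<alpha> + \<beta> * q) * (\<alpha> + \<beta> * r) + 2 * (\<alpha> + \<beta> * q) * (\<alpha> + \<beta> * s) + (\<alpha> + \<beta> * r) * (\<alpha> + \<beta> * s))
        + 1/2 * ((\<alpha> + \<beta> * p)\<^sup>2 + (\<alpha> + \<beta> * q)\<^sup>2 + (\<alpha> + \<beta> * r)\<^sup>2 + (\<alpha> + \<beta> * s)\<^sup>2) \<le> 0" for p q r s
    proof -
      obtain \<alpha> \<beta> where ab: "\<alpha> * (c a + c b + c c0 + c e) + \<beta> * (c a * p + c b * q + c c0 * r + c e * s) = 0"
        "\<alpha> \<noteq> 0 \<or> \<beta> \<noteq> 0" by (rule linear_form_kernel)
      note fp = four_point_vector[OF dist less sym(1) diag, where p = "\<alpha> + \<beta> * p" and q = "\<alpha> + \<beta> * q"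
          and r = "\<alpha> + \<beta> * r" and s = "\<alpha> + \<beta> * s"]
      show ?thesis
        using upper[of "\<lambda>i. if i = a then \<alpha> + \<beta> * p else if i = b then \<alpha> + \<beta> * q else if i = c0 then \<alpha> + \<beta> * r
          else if i = e then \<alpha> + \<beta> * s else 0"] ab
        unfolding fp dd(1-5) by (intro exI[of _ \<alpha>] exI[of _ \<beta>]) (simp add: algebra_simps)
    qed
    show False
    proof (cases "G a e")
      case True
      \<comment> \<open>For C4, the all-ones vector and the alternating vector are eigenvectors for
        4 and 0. Adding half the squared norm gives 18 and 2, with no cross term.\<close>
      obtain \<alpha> \<beta> :: real where "\<alpha> \<noteq> 0 \<or> \<beta> \<noteq> 0" "18 * \<alpha>\<^sup>2 + 2 * \<beta>\<^sup>2 \<le> 0"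
        using plane[of 1 "-1" 1 "-1"] by (auto simp: dd True algebra_simps power2_eq_square)
      moreover from this have "0 < \<alpha>\<^sup>2 + \<beta>\<^sup>2" by (simp add: sum_power2_gt_zero_iff)
      ultimately show False using zero_le_power2[of \<alpha>] zero_le_power2[of \<beta>] by linarith
    next
      case False
      \<comment> \<open>For P4 the form is 18 on the all-ones vector and -10 on (2, -3, 3, -2), with
        squared norms 4 and 26; this gives 20 and 3. The cross term vanishes because reversing the
        path fixes one vector and negates the other.\<close>
      obtain \<alpha> \<beta> :: real where "\<alpha> \<noteq> 0 \<or> \<beta> \<noteq> 0" "20 * \<alpha>\<^sup>2 + 3 * \<beta>\<^sup>2 \<le> 0"
        using plane[of 2 "-3" 3 "-2"] by (auto simp: dd False algebra_simps power2_eq_square)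
      moreover from this have "0 < \<alpha>\<^sup>2 + \<beta>\<^sup>2" by (simp add: sum_power2_gt_zero_iff)
      ultimately show False using zero_le_power2[of \<alpha>] zero_le_power2[of \<beta>] by linarith
    qed
  qed
  obtain v where v: "v < n" "\<And>i. i < n \<Longrightarrow> i \<noteq> v \<Longrightarrow> G v i"
  proof (rule G.dominating_vertex[OF n])
    show "gdist G i j \<le> 2" if "i < n" "j < n" for i j by (fact diam[OF that])
    show False if "G a b" "G b c" "G c d" "\<not> G a c" "\<not> G b d" "a \<noteq> c" "b \<noteq> d" for a b c d
      by (fact free[OF that])
  qed (rule that)

  \<comment> \<open>Degrees from the traces of the second and third powers\<close>
  define a :: "nat \<Rightarrow> nat \<Rightarrow> real" where "a i j = of_bool (G i j)" for i j
  define a' :: "nat \<Rightarrow> nat \<Rightarrow> real" where "a' i j = of_bool (?F i j)" for i j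
  have a_sym: "a i j = a j i" "a' i j = a' j i" for i j
    using G.adj_sym[of i j] G.adj_sym[of j i] F.adj_sym[of i j] F.adj_sym[of j i] by (auto simp: a_def a'_def)
  have a_vals: "a i j \<in> {0, 1}" "a i j * a i j = a i j" "a' i j * a' i j = a' i j" "a i i = 0" "a' i i = 0" for i j
    by (simp_all add: a_def a'_def)
  have d_a: "\<forall>i<n. \<forall>j<n. d i j = 2 - 2 * of_bool (i = j) - a i j"
    using d by (simp add: a_def)
  have d_a': "\<forall>i<n. \<forall>j<n. d' i j = 2 - 2 * of_bool (i = j) - a' i j"
    using F.gdist_diam2 friendship_diam[of _ k] by (simp add: d'_def a'_def assms(2))
  let ?V = "{..<n} - {v}" and ?V' = "{..<n} - {0}"
  define g where "g i = (\<Sum>j<n. a i j)" for i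
  define g' where "g' i = (\<Sum>j<n. a' i j)" for i
  define T where "T = (\<Sum>i<n. \<Sum>j<n. \<Sum>k<n. a i j * a j k * a k i)"
  define T' where "T' = (\<Sum>i<n. \<Sum>j<n. \<Sum>k<n. a' i j * a' j k * a' k i)"
  note tG = diam2_traces[where n = n, OF d_a a_sym(1) a_vals(4) a_vals(2), folded g_def T_def]
  note tF = diam2_traces[where n = n, OF d_a' a_sym(2) a_vals(5) a_vals(3), folded g'_def T'_def]
  have edges: "(\<Sum>i<n. g i) = (\<Sum>i<n. g' i)" using tr2 unfolding tG tF by simp
  have moments: "6 * (\<Sum>i<n. (g i)\<^sup>2) - T = 6 * (\<Sum>i<n. (g' i)\<^sup>2) - T'"
    using tr3 unfolding tG tF edges by simp
  have k: "real n = 2 * real k + 1" using assms(2) by simp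
  have a_v: "\<forall>j<n. a v j = 1 - of_bool (j = v)" using v(2) by (auto simp: a_def)
  have a_0: "\<forall>j<n. a' 0 j = 1 - of_bool (j = 0)"
    using assms(2) by (simp add: a'_def friendship_0)
  have gv: "g v = 2 * real k"
    using v(1) k by (simp add: g_def a_v sum_subtractf sum_of_bool_delta)
  have g0: "g' 0 = 2 * real k"
    using n k by (simp add: g'_def a_0 sum_subtractf sum_of_bool_delta)
  have g': "g' i = 2" if "i \<in> ?V'" for i
    using friendship_row_sum(2)[of i k "\<lambda>_. 1"] that assms(2) by (simp add: g'_def a'_def)
  have cardV: "real (card ?V) = 2 * real k" "real (card ?V') = 2 * real k"
    using v(1) n k by simp_all
  have split: "(\<Sum>i<n. h i) = h v + (\<Sum>i\<in>?V. h i)" "(\<Sum>i<n. h i) = h 0 + (\<Sum>i\<in>?V'. h i)" for h :: "nat \<Rightarrow> real"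
    using v(1) n by (auto intro: sum.remove)
  have "(\<Sum>i<n. g' i) = 6 * real k" "(\<Sum>i<n. (g' i)\<^sup>2) = 4 * (real k)\<^sup>2 + 8 * real k"
    unfolding split(2) using cardV(2) by (simp_all add: g0 g' power2_eq_square)
  note sums' = this
  \<comment> \<open>Each of the k triangles contributes six closed 3-walks; the inner claim counts
    the two that start at a given outer vertex.\<close>
  have T': "T' = 6 * real k"
  proof -
    have "(\<Sum>j<n. \<Sum>l<n. a' i j * a' j l * a' l i) = 2" if i: "i \<in> ?V'" for i
    proof -
      have i': "i \<in> {..<2*k+1} - {0}" using i assms(2) by simp
      note M = mate[OF i']
      have row: "(\<Sum>l<n. a' j l * x l) = x 0 + x (mate j)" if "j \<in> {..<2*k+1} - {0}" for j x
        unfolding a'_def assms(2) using friendship_row_sum(2)[OF that] .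
      have "(\<Sum>j<n. \<Sum>l<n. a' i j * a' j l * a' l i) = (\<Sum>j<n. a' i j * (\<Sum>l<n. a' i l * a' j l))"
        unfolding sum_distrib_left
      proof (intro sum.cong refl)
        fix j l
        show "a' i j * a' j l * a' l i = a' i j * (a' i l * a' j l)"
          unfolding a_sym(2)[of l i] by simp
      qed
      also have "\<dots> = a' 0 (mate i) + a' (mate i) 0"
        unfolding row[OF i'] by (simp add: a_vals)
      also have "\<dots> = 2"
        using M(1) a_0 assms(2) a_sym(2)[of "mate i" 0] by simp
      finally show ?thesis .
    qed
    then have "(\<Sum>i\<in>?V'. \<Sum>j<n. \<Sum>l<n. a' i j * a' j l * a' l i) = 4 * real k"
      using cardV(2) by simp
    then show ?thesis
      using triangles_dominating[OF n a_0 a_sym(2)] sums'(1) k unfolding T'_def g'_def by simp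
  qed
  \<comment> \<open>Walks starting at v number 6k - 4k = 2k, the ordered edges avoiding v; the
    others are bounded vertex by vertex.\<close>
  have "T \<le> (\<Sum>i\<in>?V. (g i)\<^sup>2 - g i) + 2 * real k"
  proof -
    have "(\<Sum>i\<in>?V. \<Sum>j<n. \<Sum>l<n. a i j * a j l * a l i) \<le> (\<Sum>i\<in>?V. (g i)\<^sup>2 - g i)"
      unfolding g_def by (intro sum_mono triangles_at_vertex_le a_sym(1) a_vals)
    then show ?thesis
      using triangles_dominating[OF v(1) a_v a_sym(1)] edges sums'(1) k unfolding T_def g_def by simp
  qed
  moreover have S1: "(\<Sum>i\<in>?V. g i) = 4 * real k"
    using split(1)[of g] edges sums'(1) gv by simp
  moreover have "(\<Sum>i<n. (g i)\<^sup>2) = 4 * (real k)\<^sup>2 + (\<Sum>i\<in>?V. (g i)\<^sup>2)"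
    unfolding split(1) gv by (simp add: power2_eq_square)
  \<comment> \<open>With X the sum on the left, the moment identity reads 6X = 42k + T, and T is at
    most X - 4k + 2k; hence 5X is at most 40k.\<close>
  ultimately have S2: "(\<Sum>i\<in>?V. (g i)\<^sup>2) \<le> 8 * real k"
    using moments sums'(2) T' by (simp add: sum_subtractf)
  \<comment> \<open>Variance argument: the sum is at most 8k - 16k + 8k = 0, so every degree away
    from v is exactly 2.\<close>
  have "(\<Sum>i\<in>?V. (g i - 2)\<^sup>2) = (\<Sum>i\<in>?V. (g i)\<^sup>2) - 4 * (\<Sum>i\<in>?V. g i) + 4 * real (card ?V)"
    by (simp add: power2_diff sum.distrib sum_subtractf sum_distrib_left ac_simps)
  also have "\<dots> \<le> 0" using S1 S2 cardV(1) by simp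
  finally have "(\<Sum>i\<in>?V. (g i - 2)\<^sup>2) = 0" by (intro antisym sum_nonneg) simp_all
  then have "\<forall>i\<in>?V. (g i - 2)\<^sup>2 = 0" by (subst (asm) sum_nonneg_eq_0_iff) simp_all
  then have "card {j. G i j} = 2" if "i < n" "i \<noteq> v" for i
    using that G.sum_adj_eq_card[of i] by (simp add: g_def a_def)
  then show ?thesis
    using graph_iso_friendshipI[of k G v] con v assms(2) mn by simp
qed

end
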